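(* Let $\mathfrak g$ be a non-compact simple real Lie algebra and let $\mathfrak g=\mathfrak n_+\oplus(\mathfrak a\oplus\mathfrak m)\oplus\mathfrak n_-$ be the generalized Bruhat decomposition associated with a (proper) parabolic subalgebra $\mathfrak h=\mathfrak m\oplus\mathfrak a\oplus\mathfrak n_-$. If $[\mathfrak n_+,\mathfrak n_-]\subseteq\mathfrak a\oplus\mathfrak m$, then $\mathfrak n_+$ and $\mathfrak n_-$ are commutative and $\mathfrak a$ is $1$-dimensional.
   Context: Let $\mathfrak g=\mathfrak k\oplus\mathfrak p$ be a Cartan decomposition with Cartan involution $\theta$. Up to conjugation a parabolic subalgebra is $\mathfrak h=\mathfrak m\oplus\mathfrak a\oplus\mathfrak n_-$ (Langlands decomposition), where $\mathfrak a\subset\mathfrak p$ is abelian, $\mathfrak a\oplus\mathfrak m$ is the centralizer of $\mathfrak a$ in $\mathfrak g$ with $\mathfrak m$ the Killing-orthogonal complement of $\mathfrak a$ in it, and $\mathfrak n_-$ is the nilradical of the parabolic subalgebra. Put $\mathfrak n_+=\theta(\mathfrak n_-)$. The direct sum $\mathfrak g=\mathfrak n_+\oplus(\mathfrak a\oplus\mathfrak m)\oplus\mathfrak n_-$ is the generalized Bruhat decomposition. Parabolic subalgebras are assumed proper ($\mathfrak h\ne\mathfrak g$). *)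

theory Defs
  imports "HOL-Analysis.Analysis" "HOL-Library.Set_Algebras"
begin

section \<open>Direct sums and traces in real vector spaces\<close>

definition is_direct_sum :: "'a::real_vector set \<Rightarrow> 'a set list \<Rightarrow> bool" where
  "is_direct_sum X Us \<longleftrightarrow>
     subspace X \<and> (\<forall>U\<in>set Us. subspace U \<and> U \<subseteq> X) \<and>
     (\<forall>x\<in>X. \<exists>!us. list_all2 (\<in>) us Us \<and> sum_list us = x)"

text \<open>The set \<open>extend_basis {}\<close> is some basis of the whole space; \<open>lin_trace_eq\<close> below shows
  that the trace does not depend on it.\<close>

definition lin_trace :: "('a::real_vector \<Rightarrow> 'a) \<Rightarrow> real" where
  "lin_trace f = (\<Sum>b\<in>extend_basis {}. representation (extend_basis {}) (f b) b)"

lemma trace_sum_basis_indep: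
  fixes f :: "'a::real_vector \<Rightarrow> 'a"
  assumes f: "linear f"
    and B: "independent B" "span B = UNIV" "finite B"
    and C: "independent C" "span C = UNIV" "finite C"
  shows "(\<Sum>b\<in>B. representation B (f b) b) = (\<Sum>c\<in>C. representation C (f c) c)"
proof -
  have expand: "(\<Sum>d\<in>D. representation D x d *\<^sub>R d) = x"
    if "independent D" "span D = UNIV" "finite D" for D and x :: 'a
    using that by (intro real_vector.sum_representation_eq) auto
  have rep_sum: "representation D (\<Sum>e\<in>E. r e *\<^sub>R g e) d = (\<Sum>e\<in>E. r e * representation D (g e) d)"
    if "independent D" "span D = UNIV" for D E and r :: "'a \<Rightarrow> real" and g :: "'a \<Rightarrow> 'a" and d
    using that by (simp add: real_vector.representation_sum real_vector.representation_scale)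
  have "(\<Sum>b\<in>B. representation B (f b) b)
      = (\<Sum>b\<in>B. \<Sum>c\<in>C. representation C b c * representation B (f c) b)"
  proof (rule sum.cong[OF refl])
    fix b
    have "f b = f (\<Sum>c\<in>C. representation C b c *\<^sub>R c)"
      by (simp only: expand[OF C])
    also have "\<dots> = (\<Sum>c\<in>C. representation C b c *\<^sub>R f c)"
      using f by (simp add: linear_sum linear_cmul)
    finally show "representation B (f b) b = (\<Sum>c\<in>C. representation C b c * representation B (f c) b)"
      using rep_sum[OF B(1,2)] by metis
  qed
  also have "\<dots> = (\<Sum>c\<in>C. \<Sum>b\<in>B. representation B (f c) b * representation C b c)"
    by (subst sum.swap) (simp add: mult.commute)
  also have "\<dots> = (\<Sum>c\<in>C. representation C (f c) c)"
  proof (rule sum.cong[OF refl])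
    fix c
    have "f c = (\<Sum>b\<in>B. representation B (f c) b *\<^sub>R b)"
      by (simp only: expand[OF B])
    then show "(\<Sum>b\<in>B. representation B (f c) b * representation C b c) = representation C (f c) c"
      using rep_sum[OF C(1,2), of "representation B (f c)" "\<lambda>b. b" B c] by metis
  qed
  finally show ?thesis .
qed

lemma lin_trace_eq:
  fixes f :: "'a::real_vector \<Rightarrow> 'a"
  assumes "linear f" "independent B" "span B = UNIV" "finite B"
  shows "lin_trace f = (\<Sum>b\<in>B. representation B (f b) b)"
proof -
  have C: "independent (extend_basis {} :: 'a set)" "span (extend_basis {} :: 'a set) = UNIV"
    by (simp_all add: real_vector.independent_extend_basis real_vector.span_extend_basis
        real_vector.independent_empty)
  have "finite (extend_basis {} :: 'a set)"
    using real_vector.independent_span_bound[OF assms(4) C(1)] assms(3) by auto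
  then show ?thesis
    unfolding lin_trace_def using trace_sum_basis_indep[OF assms(1) C] assms by metis
qed

section \<open>Finite-dimensional real Lie algebras\<close>

text \<open>The underlying vector space is a whole type; \<open>br\<close> is the Lie bracket.\<close>

definition lie_algebra :: "('a::real_vector \<Rightarrow> 'a \<Rightarrow> 'a) \<Rightarrow> bool" where
  "lie_algebra br \<longleftrightarrow>
     (\<exists>B::'a set. finite B \<and> span B = UNIV) \<and>
     bilinear br \<and>
     (\<forall>x. br x x = 0) \<and>
     (\<forall>x y z. br x (br y z) + br y (br z x) + br z (br x y) = 0)"

definition bracket_span :: "('a::real_vector \<Rightarrow> 'a \<Rightarrow> 'a) \<Rightarrow> 'a set \<Rightarrow> 'a set \<Rightarrow> 'a set" where
  "bracket_span br A B = span {br x y |x y. x \<in> A \<and> y \<in> B}"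

definition lie_subalgebra :: "('a::real_vector \<Rightarrow> 'a \<Rightarrow> 'a) \<Rightarrow> 'a set \<Rightarrow> bool" where
  "lie_subalgebra br h \<longleftrightarrow> subspace h \<and> (\<forall>x\<in>h. \<forall>y\<in>h. br x y \<in> h)"

definition lie_ideal :: "('a::real_vector \<Rightarrow> 'a \<Rightarrow> 'a) \<Rightarrow> 'a set \<Rightarrow> 'a set \<Rightarrow> bool" where
  "lie_ideal br h I \<longleftrightarrow> subspace I \<and> I \<subseteq> h \<and> (\<forall>x\<in>h. \<forall>y\<in>I. br x y \<in> I)"

definition lie_commutative :: "('a::real_vector \<Rightarrow> 'a \<Rightarrow> 'a) \<Rightarrow> 'a set \<Rightarrow> bool" where
  "lie_commutative br h \<longleftrightarrow> (\<forall>x\<in>h. \<forall>y\<in>h. br x y = 0)"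

definition simple_lie_algebra :: "('a::real_vector \<Rightarrow> 'a \<Rightarrow> 'a) \<Rightarrow> bool" where
  "simple_lie_algebra br \<longleftrightarrow>
     lie_algebra br \<and> \<not> lie_commutative br UNIV \<and> (\<forall>I. lie_ideal br UNIV I \<longrightarrow> I = {0} \<or> I = UNIV)"

fun derived_series :: "('a::real_vector \<Rightarrow> 'a \<Rightarrow> 'a) \<Rightarrow> 'a set \<Rightarrow> nat \<Rightarrow> 'a set" where
  "derived_series br h 0 = h"
| "derived_series br h (Suc k) = bracket_span br (derived_series br h k) (derived_series br h k)"

fun lower_central_series :: "('a::real_vector \<Rightarrow> 'a \<Rightarrow> 'a) \<Rightarrow> 'a set \<Rightarrow> nat \<Rightarrow> 'a set" where
  "lower_central_series br h 0 = h"
| "lower_central_series br h (Suc k) = bracket_span br h (lower_central_series br h k)"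

definition lie_solvable :: "('a::real_vector \<Rightarrow> 'a \<Rightarrow> 'a) \<Rightarrow> 'a set \<Rightarrow> bool" where
  "lie_solvable br h \<longleftrightarrow> (\<exists>k. derived_series br h k = {0})"

definition lie_nilpotent :: "('a::real_vector \<Rightarrow> 'a \<Rightarrow> 'a) \<Rightarrow> 'a set \<Rightarrow> bool" where
  "lie_nilpotent br h \<longleftrightarrow> (\<exists>k. lower_central_series br h k = {0})"

definition is_nilradical :: "('a::real_vector \<Rightarrow> 'a \<Rightarrow> 'a) \<Rightarrow> 'a set \<Rightarrow> 'a set \<Rightarrow> bool" where
  "is_nilradical br h n \<longleftrightarrow>
     lie_ideal br h n \<and> lie_nilpotent br n \<and>
     (\<forall>I. lie_ideal br h I \<and> lie_nilpotent br I \<longrightarrow> I \<subseteq> n)"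

definition centralizer :: "('a::real_vector \<Rightarrow> 'a \<Rightarrow> 'a) \<Rightarrow> 'a set \<Rightarrow> 'a set" where
  "centralizer br A = {x. \<forall>y\<in>A. br x y = 0}"

definition killing_form :: "('a::real_vector \<Rightarrow> 'a \<Rightarrow> 'a) \<Rightarrow> 'a \<Rightarrow> 'a \<Rightarrow> real" where
  "killing_form br x y = lin_trace (br x \<circ> br y)"

text \<open>A (semisimple) real Lie algebra is compact iff its Killing form is negative definite.\<close>

definition compact_lie_algebra :: "('a::real_vector \<Rightarrow> 'a \<Rightarrow> 'a) \<Rightarrow> bool" where
  "compact_lie_algebra br \<longleftrightarrow> (\<forall>x. x \<noteq> 0 \<longrightarrow> killing_form br x x < 0)"

definition cartan_involution :: "('a::real_vector \<Rightarrow> 'a \<Rightarrow> 'a) \<Rightarrow> ('a \<Rightarrow> 'a) \<Rightarrow> bool" where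
  "cartan_involution br \<theta> \<longleftrightarrow>
     linear \<theta> \<and> (\<forall>x y. \<theta> (br x y) = br (\<theta> x) (\<theta> y)) \<and> (\<forall>x. \<theta> (\<theta> x) = x) \<and>
     (\<forall>x. x \<noteq> 0 \<longrightarrow> - killing_form br x (\<theta> x) > 0)"

definition cartan_decomposition ::
  "('a::real_vector \<Rightarrow> 'a \<Rightarrow> 'a) \<Rightarrow> ('a \<Rightarrow> 'a) \<Rightarrow> 'a set \<Rightarrow> 'a set \<Rightarrow> bool" where
  "cartan_decomposition br \<theta> k p \<longleftrightarrow>
     cartan_involution br \<theta> \<and> k = {x. \<theta> x = x} \<and> p = {x. \<theta> x = - x}"

section \<open>Parabolic subalgebras\<close>

text \<open>The pair \<open>(x, y)\<close> stands for \<open>x + i y\<close> in the complexification, so the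
  complexification of a subspace \<open>h\<close> is \<open>h \<times> h\<close>.\<close>

definition complexified_bracket ::
  "('a::real_vector \<Rightarrow> 'a \<Rightarrow> 'a) \<Rightarrow> 'a \<times> 'a \<Rightarrow> 'a \<times> 'a \<Rightarrow> 'a \<times> 'a" where
  "complexified_bracket br = (\<lambda>(x, y) (u, v). (br x u - br y v, br x v + br y u))"

definition complex_subalgebra ::
  "('a::real_vector \<Rightarrow> 'a \<Rightarrow> 'a) \<Rightarrow> ('a \<times> 'a) set \<Rightarrow> bool" where
  "complex_subalgebra br S \<longleftrightarrow>
     lie_subalgebra (complexified_bracket br) S \<and> (\<forall>(x, y)\<in>S. (- y, x) \<in> S)"

text \<open>Solvability over \<open>\<real>\<close> and over the complex numbers agree for complex subalgebras, since the
  real span of the brackets of two complex subspaces is already a complex subspace.\<close>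

definition borel_subalgebra ::
  "('a::real_vector \<Rightarrow> 'a \<Rightarrow> 'a) \<Rightarrow> ('a \<times> 'a) set \<Rightarrow> bool" where
  "borel_subalgebra br b \<longleftrightarrow>
     complex_subalgebra br b \<and> lie_solvable (complexified_bracket br) b \<and>
     (\<forall>b'. complex_subalgebra br b' \<and> lie_solvable (complexified_bracket br) b' \<and> b \<subseteq> b'
        \<longrightarrow> b' = b)"

definition parabolic_subalgebra :: "('a::real_vector \<Rightarrow> 'a \<Rightarrow> 'a) \<Rightarrow> 'a set \<Rightarrow> bool" where
  "parabolic_subalgebra br h \<longleftrightarrow>
     lie_subalgebra br h \<and> (\<exists>b. borel_subalgebra br b \<and> b \<subseteq> h \<times> h)"

definition langlands_decomposition ::
  "('a::real_vector \<Rightarrow> 'a \<Rightarrow> 'a) \<Rightarrow> 'a set \<Rightarrow> 'a set \<Rightarrow> 'a set \<Rightarrow> 'a set \<Rightarrow> 'a set \<Rightarrow> bool" where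
  "langlands_decomposition br p h m a n_minus \<longleftrightarrow>
     subspace a \<and> a \<subseteq> p \<and> lie_commutative br a \<and>
     m = {x \<in> centralizer br a. \<forall>y\<in>a. killing_form br x y = 0} \<and>
     is_direct_sum (centralizer br a) [a, m] \<and>
     is_nilradical br h n_minus \<and>
     is_direct_sum h [m, a, n_minus]"

text \<open>In the following \<open>a + m\<close> is the elementwise sum of the two subspaces.\<close>

definition generalized_bruhat_decomposition ::
  "('a::real_vector \<Rightarrow> 'a \<Rightarrow> 'a) \<Rightarrow> ('a \<Rightarrow> 'a) \<Rightarrow> 'a set \<Rightarrow> 'a set \<Rightarrow>
     'a set \<Rightarrow> 'a set \<Rightarrow> 'a set \<Rightarrow> 'a set \<Rightarrow> bool" where
  "generalized_bruhat_decomposition br \<theta> p h n_plus a m n_minus \<longleftrightarrow>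
     langlands_decomposition br p h m a n_minus \<and>
     n_plus = \<theta> ` n_minus \<and>
     is_direct_sum UNIV [n_plus, a + m, n_minus]"

end

theory Submission
  imports Defs "HOL-Computational_Algebra.Fundamental_Theorem_Algebra"
begin

text \<open>Write \<open>N\<close> for \<open>\<nn>\<^sub>-\<close> and \<open>L\<close> for \<open>\<aa> + \<mm>\<close>, the centralizer of \<open>\<aa>\<close>, and let
  \<open>\<langle>x, y\<rangle> = - K(x, \<theta> y)\<close>, an inner product for which the adjoint of \<open>ad z\<close> is \<open>- ad (\<theta> z)\<close>. As \<open>N\<close> is
  spanned by \<open>[\<aa>, N]\<close>, it is orthogonal to \<open>L\<close>. For \<open>x, y \<in> N\<close> and \<open>w = [x, y]\<close>, invariance of \<open>K\<close>
  gives \<open>\<langle>w, w\<rangle> = - K(x, [y, \<theta> w])\<close>, which vanishes because \<open>[y, \<theta> w] \<in> L\<close>; so \<open>N\<close> is commutative.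
  For a nonzero \<open>L\<close>-submodule \<open>V\<close> of \<open>N\<close> the space \<open>V + [V, \<theta> V] + \<theta> V\<close> is an ideal, so simplicity
  forces \<open>V = N\<close>. Each \<open>ad H\<close> with \<open>H \<in> \<aa>\<close> is symmetric and commutes with \<open>L\<close>, so one of its
  eigenspaces in \<open>N\<close> is all of \<open>N\<close>. Hence \<open>\<aa>\<close> acts on \<open>N\<close> through a linear form, which is injective
  because the center is trivial.\<close>

section \<open>Symmetric operators on finite-dimensional spaces\<close>

text \<open>Gram-Schmidt without normalisation: the new generator \<open>b\<close> is replaced by
  \<open>b - s\<close>, which is orthogonal to \<open>span S\<close>, and the projection of
  \<open>x\<close> gains a multiple of it. If \<open>b\<close> already lies in
  \<open>span S\<close>, then \<open>b - s\<close> vanishes.\<close>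

lemma orthogonal_decomposition_finite:
  fixes f :: "'a::real_vector \<Rightarrow> 'a \<Rightarrow> real"
  assumes f: "bilinear f"
    and pos: "\<And>x. x \<noteq> 0 \<Longrightarrow> f x x > 0"
    and "finite S"
  shows "\<exists>s\<in>span S. \<forall>t\<in>span S. f (x - s) t = 0"
  using \<open>finite S\<close>
proof (induction S arbitrary: x)
  case empty
  then show ?case using f by (simp add: bilinear_rzero)
next
  case (insert b S)
  obtain s where s: "s \<in> span S" "\<And>t. t \<in> span S \<Longrightarrow> f (b - s) t = 0"
    using insert.IH by blast
  obtain u where u: "u \<in> span S" "\<And>t. t \<in> span S \<Longrightarrow> f (x - u) t = 0"
    using insert.IH by blast
  define c where "c = f (x - u) (b - s) / f (b - s) (b - s)"
  define v where "v = u + c *\<^sub>R (b - s)"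
  have xv: "x - v = (x - u) - c *\<^sub>R (b - s)"
    by (simp add: v_def)
  have orth_b: "f (x - v) (b - s) = 0"
  proof (cases "b - s = 0")
    case True
    then show ?thesis using f by (simp only: bilinear_rzero)
  next
    case False
    from pos[OF this] have "f (b - s) (b - s) \<noteq> 0" by simp
    then show ?thesis
      unfolding xv c_def by (simp only: bilinear_lsub[OF f] bilinear_lmul[OF f]) simp
  qed
  have orth_S: "f (x - v) t = 0" if "t \<in> span S" for t
    unfolding xv using s(2)[OF that] u(2)[OF that]
    by (simp only: bilinear_lsub[OF f, of "x - u"] bilinear_lmul[OF f]) simp
  show ?case
  proof (intro bexI ballI)
    have sub: "span S \<subseteq> span (insert b S)" by (intro span_mono) auto
    show "v \<in> span (insert b S)"
      unfolding v_def using sub s(1) u(1)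
      by (intro span_add span_scale span_diff) (auto intro: span_base)
    fix t assume "t \<in> span (insert b S)"
    then obtain k where k: "t - k *\<^sub>R b \<in> span S" by (auto simp: span_breakdown_eq)
    have "t - k *\<^sub>R (b - s) = (t - k *\<^sub>R b) + k *\<^sub>R s" by (simp add: algebra_simps)
    also have "\<dots> \<in> span S" using k s(1) by (intro span_add span_scale)
    finally have "f (x - v) (t - k *\<^sub>R (b - s)) = 0" by (rule orth_S)
    then show "f (x - v) t = 0"
      using orth_b by (simp only: bilinear_rsub[OF f, of "x - v" t] bilinear_rmul[OF f]) simp
  qed
qed

lemma orthogonal_decomposition:
  fixes f :: "'a::real_vector \<Rightarrow> 'a \<Rightarrow> real"
  assumes f: "bilinear f"
    and pos: "\<And>x. x \<noteq> 0 \<Longrightarrow> f x x > 0"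
    and V: "subspace V"
    and B: "finite B" "span B = (UNIV :: 'a set)"
  obtains v t where "v \<in> V" "x = v + t" "\<And>w. w \<in> V \<Longrightarrow> f t w = 0"
proof -
  obtain C where C: "C \<subseteq> V" "independent C" "V \<subseteq> span C"
    using real_vector.maximal_independent_subset by blast
  have "finite C"
    using real_vector.independent_span_bound[OF B(1) C(2)] B(2) by auto
  moreover have "span C = V"
    using C V by (simp add: span_minimal subset_antisym)
  ultimately obtain s where "s \<in> V" "\<forall>t\<in>V. f (x - s) t = 0"
    using orthogonal_decomposition_finite[OF f pos] by metis
  with that[of s "x - s"] show thesis by auto
qed

section \<open>Polynomials evaluated at an operator\<close>

definition poly_op :: "real poly \<Rightarrow> ('a::real_vector \<Rightarrow> 'a) \<Rightarrow> 'a \<Rightarrow> 'a" where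
  "poly_op p T x = (\<Sum>i\<le>degree p. coeff p i *\<^sub>R (T ^^ i) x)"

lemma poly_op_eq_sum:
  assumes "degree p \<le> n"
  shows "poly_op p T x = (\<Sum>i\<le>n. coeff p i *\<^sub>R (T ^^ i) x)"
  unfolding poly_op_def using assms
  by (intro sum.mono_neutral_left) (auto simp: coeff_eq_0)

lemma poly_op_0 [simp]: "poly_op 0 T x = 0"
  by (simp add: poly_op_def)

lemma poly_op_add: "poly_op (p + q) T x = poly_op p T x + poly_op q T x"
proof -
  let ?n = "max (degree p) (degree q)"
  have "degree (p + q) \<le> ?n" by (rule degree_add_le_max)
  then show ?thesis
    by (simp add: poly_op_eq_sum[of _ ?n] sum.distrib scaleR_add_left)
qed

lemma poly_op_smult: "poly_op (smult a p) T x = a *\<^sub>R poly_op p T x"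
  by (simp add: poly_op_eq_sum[OF degree_smult_le] poly_op_def scaleR_sum_right)

lemma poly_op_pCons:
  assumes "linear T"
  shows "poly_op (pCons a p) T x = a *\<^sub>R x + T (poly_op p T x)"
proof -
  have "poly_op (pCons a p) T x = (\<Sum>i\<le>Suc (degree p). coeff (pCons a p) i *\<^sub>R (T ^^ i) x)"
    by (rule poly_op_eq_sum) (rule degree_pCons_le)
  also have "\<dots> = a *\<^sub>R x + (\<Sum>i\<le>degree p. coeff p i *\<^sub>R T ((T ^^ i) x))"
    by (subst sum.atMost_Suc_shift) simp
  also have "(\<Sum>i\<le>degree p. coeff p i *\<^sub>R T ((T ^^ i) x)) = T (poly_op p T x)"
    using assms by (simp add: poly_op_def linear_sum linear_cmul)
  finally show ?thesis .
qed

lemma poly_op_mult: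
  assumes "linear T"
  shows "poly_op (p * q) T x = poly_op p T (poly_op q T x)"
  by (induction p) (simp_all add: mult_pCons_left poly_op_add poly_op_smult poly_op_pCons[OF assms])

lemma poly_op_in_subspace:
  assumes "subspace N" "\<And>x. x \<in> N \<Longrightarrow> T x \<in> N" "x \<in> N"
  shows "poly_op p T x \<in> N"
proof -
  have "(T ^^ i) x \<in> N" for i
    using assms by (induction i) auto
  then show ?thesis
    unfolding poly_op_def using assms(1) by (intro subspace_sum subspace_scale)
qed

text \<open>The \<open>card B + 1\<close> vectors from \<open>x\<close> to
  \<open>(T ^^ card B) x\<close> are too many to be independent, and the coefficients of a linear
  relation between them form \<open>p\<close>.\<close>

lemma annihilating_poly:
  fixes x :: "'a::real_vector"
  assumes B: "finite B" "span B = (UNIV :: 'a set)"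
  obtains p where "p \<noteq> 0" "poly_op p T x = 0"
proof -
  let ?n = "card B" and ?g = "\<lambda>i. (T ^^ i) x"
  have "\<exists>u. (\<exists>i\<le>?n. u i \<noteq> 0) \<and> (\<Sum>i\<le>?n. u i *\<^sub>R ?g i) = 0"
  proof (cases "inj_on ?g {..?n}")
    case False
    then obtain i j where ij: "i \<le> ?n" "j \<le> ?n" "i \<noteq> j" "?g i = ?g j"
      by (auto simp: inj_on_def)
    \<comment> \<open>Two equal powers give a relation with coefficients \<open>1\<close> and
      \<open>-1\<close>; passing to the image set would merge them.\<close>
    let ?u = "\<lambda>k. (if k = i then 1 else 0) - (if k = j then 1 else (0::real))"
    have "(\<Sum>k\<le>?n. ?u k *\<^sub>R ?g k) = (\<Sum>k\<le>?n. if k = i then ?g k else 0) - (\<Sum>k\<le>?n. if k = j then ?g k else 0)"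
      by (subst sum_subtractf[symmetric]) (intro sum.cong, auto)
    also have "\<dots> = 0" using ij by simp
    finally show ?thesis using ij by (intro exI[of _ ?u]) auto
  next
    case True
    then have "card (?g ` {..?n}) = Suc ?n" by (simp add: card_image)
    then have "dependent (?g ` {..?n})"
      using real_vector.independent_span_bound[OF B(1), of "?g ` {..?n}"] B(2) by fastforce
    then obtain w where w: "\<exists>v\<in>?g ` {..?n}. w v \<noteq> 0" "(\<Sum>v\<in>?g ` {..?n}. w v *\<^sub>R v) = 0"
      using real_vector.dependent_finite[of "?g ` {..?n}"] by auto
    then have "(\<Sum>i\<le>?n. w (?g i) *\<^sub>R ?g i) = 0"
      by (simp add: sum.reindex[OF True])
    with w(1) show ?thesis by (intro exI[of _ "\<lambda>i. w (?g i)"]) auto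
  qed
  then obtain u i where u: "i \<le> ?n" "u i \<noteq> 0" "(\<Sum>i\<le>?n. u i *\<^sub>R ?g i) = 0" by auto
  define p where "p = (\<Sum>i\<le>?n. monom (u i) i)"
  have coeff: "coeff p j = (if j \<le> ?n then u j else 0)" for j
    by (simp add: p_def coeff_sum)
  show thesis
  proof
    show "p \<noteq> 0" using coeff[of i] u by auto
    have "degree p \<le> ?n" by (rule degree_le) (simp add: coeff)
    then show "poly_op p T x = 0"
      using u(3) by (simp add: poly_op_eq_sum[of p ?n] coeff)
  qed
qed

text \<open>A complex root \<open>z\<close> yields the linear factor at \<open>Re z\<close> if it is
  real, and otherwise the real quadratic whose roots are \<open>z\<close> and its conjugate.\<close>

lemma real_poly_factor:
  fixes p :: "real poly"
  assumes "degree p > 0"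
  obtains c q where "p = [:-c, 1:] * q"
  | a b q where "b \<noteq> 0" "p = [:a\<^sup>2 + b\<^sup>2, -2 * a, 1:] * q"
proof -
  have "degree (map_poly complex_of_real p) = degree p"
    by (rule degree_map_poly) simp
  then have "\<not> constant (poly (map_poly complex_of_real p))"
    using assms by (simp add: constant_degree)
  then obtain z where z: "poly (map_poly complex_of_real p) z = 0"
    using fundamental_theorem_of_algebra by blast
  show thesis
  proof (cases "Im z = 0")
    case True
    then have "z = of_real (Re z)" by (simp add: complex_eq_iff)
    moreover have "poly (map_poly complex_of_real p) (of_real c) = of_real (poly p c)" for c
      by (induction p) (auto simp: map_poly_pCons)
    ultimately have "poly p (Re z) = 0"
      using z by (metis of_real_eq_0_iff)
    then have "[:- Re z, 1:] dvd p" by (simp add: poly_eq_0_iff_dvd)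
    with that(1) show thesis by (elim dvdE)
  next
    case False
    define Q where "Q = [:(Re z)\<^sup>2 + (Im z)\<^sup>2, -2 * Re z, 1:]"
    have Q: "poly (map_poly complex_of_real Q) z = 0"
      by (simp add: Q_def complex_eq_iff map_poly_pCons power2_eq_square algebra_simps)
    have "degree Q = 2" by (simp add: Q_def)
    have hom: "map_poly complex_of_real (f * g) = map_poly complex_of_real f * map_poly complex_of_real g"
      "map_poly complex_of_real (f + g) = map_poly complex_of_real f + map_poly complex_of_real g" for f g
      by (auto simp: poly_eq_iff coeff_map_poly coeff_mult)
    have "poly (map_poly complex_of_real (Q * (p div Q) + p mod Q)) z = 0"
      using z by simp
    then have "poly (map_poly complex_of_real (p mod Q)) z = 0"
      unfolding hom using Q by simp
    moreover obtain r0 r1 where r: "p mod Q = [:r0, r1:]"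
    proof -
      have "degree (p mod Q) \<le> 1"
        using degree_mod_less[of Q p] \<open>degree Q = 2\<close> by (cases "p mod Q = 0") (auto simp: Q_def)
      then have "p mod Q = [:coeff (p mod Q) 0, coeff (p mod Q) 1:]"
        by (auto simp: poly_eq_iff coeff_pCons coeff_eq_0 split: nat.split)
      with that show thesis by blast
    qed
    \<comment> \<open>A real polynomial of degree at most 1 that vanishes at the non-real
      \<open>z\<close> is zero: the imaginary part gives \<open>r1\<close>, the real part
      \<open>r0\<close>.\<close>
    ultimately have "r1 = 0" "r0 = 0" using False
      by (auto simp: map_poly_pCons complex_eq_iff)
    with r have "Q dvd p" by (simp add: mod_eq_0_iff_dvd)
    then obtain q where "p = Q * q" ..
    with that(2) False show thesis unfolding Q_def by blast
  qed
qed

text \<open>Split a linear or quadratic factor off \<open>p\<close>, with cofactor \<open>q\<close>.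
  Either \<open>q\<close> already kills \<open>x\<close> and has smaller degree, or
  \<open>poly_op q T x\<close> is a nonzero vector killed by the factor. A linear factor makes it an
  eigenvector; a quadratic one contradicts positivity.\<close>

lemma symmetric_eigenvector_annihilated:
  fixes f :: "'a::real_vector \<Rightarrow> 'a \<Rightarrow> real"
  assumes f: "bilinear f"
    and pos: "\<And>x. x \<noteq> 0 \<Longrightarrow> f x x > 0"
    and T: "linear T" "\<And>x y. f (T x) y = f x (T y)"
    and N: "subspace N" "\<And>x. x \<in> N \<Longrightarrow> T x \<in> N"
    and "x \<in> N" "x \<noteq> 0" "p \<noteq> 0" "poly_op p T x = 0"
  shows "\<exists>y\<in>N. y \<noteq> 0 \<and> (\<exists>c. T y = c *\<^sub>R y)"
  using \<open>p \<noteq> 0\<close> \<open>poly_op p T x = 0\<close>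
proof (induction "degree p" arbitrary: p rule: less_induct)
  case less
  have "degree p > 0"
  proof (rule ccontr)
    assume "\<not> degree p > 0"
    then obtain a where "p = [:a:]" by (auto elim: degree_eq_zeroE)
    with less.prems \<open>x \<noteq> 0\<close> show False by (simp add: poly_op_def)
  qed
  then show ?case
  proof (cases rule: real_poly_factor)
    case (1 c q)
    let ?y = "poly_op q T x"
    show ?thesis
    proof (cases "?y = 0")
      case True
      from 1 less.prems have "q \<noteq> 0" by auto
      then have "degree q < degree p" unfolding 1 by (subst degree_mult_eq) auto
      with less.hyps \<open>q \<noteq> 0\<close> True show ?thesis by blast
    next
      case False
      have "poly_op p T x = T ?y - c *\<^sub>R ?y"
        unfolding 1 poly_op_mult[OF T(1)] by (simp add: poly_op_pCons[OF T(1)] linear_0[OF T(1)])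
      then have "T ?y = c *\<^sub>R ?y"
        using less.prems(2) by (metis right_minus_eq)
      then show ?thesis
        using False poly_op_in_subspace[OF N \<open>x \<in> N\<close>, where p = q] by (intro bexI[of _ ?y]) auto
    qed
  next
    case (2 a b q)
    let ?y = "poly_op q T x"
    show ?thesis
    proof (cases "?y = 0")
      case True
      from 2 less.prems have "q \<noteq> 0" by auto
      then have "degree q < degree p" unfolding 2 by (subst degree_mult_eq) auto
      with less.hyps \<open>q \<noteq> 0\<close> True show ?thesis by blast
    next
      case False
      let ?u = "T ?y - a *\<^sub>R ?y"
      have Q: "(a\<^sup>2 + b\<^sup>2) *\<^sub>R ?y + T ((-2 * a) *\<^sub>R ?y + T ?y) = 0"
        using less.prems(2)
        unfolding 2 poly_op_mult[OF T(1)] by (simp add: poly_op_pCons[OF T(1)] linear_0[OF T(1)])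
      have "T ((-2 * a) *\<^sub>R ?y + T ?y) = (-2 * a) *\<^sub>R T ?y + T (T ?y)"
        by (simp only: linear_add[OF T(1)] linear_cmul[OF T(1)])
      \<comment> \<open>Pair \<open>Q\<close> with \<open>?y\<close> and complete the square:
        symmetry of \<open>T\<close> turns the relation into a sum of the squared norm of
        \<open>?u\<close> and \<open>b\<^sup>2\<close> times that of \<open>?y\<close>, and the
        second term is positive.\<close>
      with Q have "0 = f ((a\<^sup>2 + b\<^sup>2) *\<^sub>R ?y + ((-2 * a) *\<^sub>R T ?y + T (T ?y))) ?y"
        using f by (simp only: bilinear_lzero)
      also have "\<dots> = (a\<^sup>2 + b\<^sup>2) * f ?y ?y - 2 * a * f (T ?y) ?y + f (T ?y) (T ?y)"
        by (simp only: bilinear_ladd[OF f] bilinear_lmul[OF f] T(2)[of "T ?y" ?y]) simp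
      also have "\<dots> = f ?u ?u + b\<^sup>2 * f ?y ?y"
        by (simp only: bilinear_lsub[OF f] bilinear_rsub[OF f] bilinear_lmul[OF f] bilinear_rmul[OF f]
            T(2)[of ?y ?y, symmetric]) (simp add: power2_eq_square algebra_simps)
      finally have "f ?u ?u + b\<^sup>2 * f ?y ?y = 0" by simp
      moreover have "f ?u ?u \<ge> 0"
        using pos[of ?u] f by (cases "?u = 0") (simp_all only: bilinear_lzero less_imp_le order_refl simp_thms)
      moreover have "b\<^sup>2 * f ?y ?y > 0"
        using 2 pos[OF False] by simp
      ultimately show ?thesis by simp
    qed
  qed
qed

lemma symmetric_eigenvector:
  fixes f :: "'a::real_vector \<Rightarrow> 'a \<Rightarrow> real"
  assumes "bilinear f" "\<And>x. x \<noteq> 0 \<Longrightarrow> f x x > 0"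
    and "linear T" "\<And>x y. f (T x) y = f x (T y)"
    and "subspace N" "\<And>x. x \<in> N \<Longrightarrow> T x \<in> N" "N \<noteq> {0}"
    and B: "finite B" "span B = (UNIV :: 'a set)"
  obtains y c where "y \<in> N" "y \<noteq> 0" "T y = c *\<^sub>R y"
proof -
  obtain x where x: "x \<in> N" "x \<noteq> 0"
    using assms(5,7) subspace_0 by blast
  obtain p where p: "p \<noteq> 0" "poly_op p T x = 0"
    using annihilating_poly[OF B] by blast
  show thesis
    using symmetric_eigenvector_annihilated[OF assms(1-6) x p] that by blast
qed

section \<open>The Killing form and the Cartan inner product\<close>

text \<open>Both traces are double sums of products of matrix entries, differing only in the order
  of summation.\<close>

lemma lin_trace_commute:
  fixes f g :: "'a::real_vector \<Rightarrow> 'a"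
  assumes f: "linear f" and g: "linear g" and B: "finite B" "span B = (UNIV :: 'a set)"
  shows "lin_trace (f \<circ> g) = lin_trace (g \<circ> f)"
proof -
  let ?E = "extend_basis {} :: 'a set"
  have E: "independent ?E" "span ?E = UNIV"
    by (simp_all add: real_vector.independent_extend_basis real_vector.span_extend_basis
        real_vector.independent_empty)
  have "finite ?E"
    using real_vector.independent_span_bound[OF B(1) E(1)] B(2) by auto
  have comp: "lin_trace (f \<circ> g) = (\<Sum>b\<in>?E. \<Sum>c\<in>?E. representation ?E (g b) c * representation ?E (f c) b)"
    if "linear f" for f g :: "'a \<Rightarrow> 'a"
    unfolding lin_trace_def
  proof (rule sum.cong[OF refl])
    fix b
    have "g b = (\<Sum>c\<in>?E. representation ?E (g b) c *\<^sub>R c)"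
      by (rule real_vector.sum_representation_eq[symmetric]) (use E \<open>finite ?E\<close> in auto)
    then have "f (g b) = (\<Sum>c\<in>?E. representation ?E (g b) c *\<^sub>R f c)"
      by (metis (no_types, lifting) linear_sum[OF that] linear_cmul[OF that] sum.cong)
    then show "representation ?E ((f \<circ> g) b) b = (\<Sum>c\<in>?E. representation ?E (g b) c * representation ?E (f c) b)"
      using E by (simp add: real_vector.representation_sum real_vector.representation_scale)
  qed
  show ?thesis
    unfolding comp[OF f] comp[OF g]
    by (subst sum.swap) (simp add: mult.commute)
qed

lemma lin_trace_add:
  fixes f g :: "'a::real_vector \<Rightarrow> 'a"
  shows "lin_trace (\<lambda>x. f x + g x) = lin_trace f + lin_trace g"
  by (simp add: lin_trace_def real_vector.representation_add real_vector.independent_extend_basis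
      real_vector.span_extend_basis real_vector.independent_empty sum.distrib)

lemma lin_trace_cmul:
  fixes f :: "'a::real_vector \<Rightarrow> 'a"
  shows "lin_trace (\<lambda>x. c *\<^sub>R f x) = c * lin_trace f"
  by (simp add: lin_trace_def real_vector.representation_scale real_vector.independent_extend_basis
      real_vector.span_extend_basis real_vector.independent_empty sum_distrib_left)

locale cartan_lie_algebra =
  fixes br :: "'a::real_vector \<Rightarrow> 'a \<Rightarrow> 'a" and \<theta> :: "'a \<Rightarrow> 'a"
  assumes lie: "lie_algebra br" and cartan: "cartan_involution br \<theta>"
begin

abbreviation "K \<equiv> killing_form br"

definition ip :: "'a \<Rightarrow> 'a \<Rightarrow> real" where
  "ip x y = - K x (\<theta> y)"

lemma finite_span: obtains B :: "'a set" where "finite B" "span B = UNIV"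
  using lie unfolding lie_algebra_def by blast

lemma bil: "bilinear br" and br_self: "br x x = 0"
  using lie unfolding lie_algebra_def by auto

lemma linear_br: "linear (br x)"
  using bil unfolding bilinear_def by auto

lemmas br_simps = bilinear_ladd[OF bil] bilinear_radd[OF bil] bilinear_lmul[OF bil]
  bilinear_rmul[OF bil] bilinear_lneg[OF bil] bilinear_rneg[OF bil] bilinear_lsub[OF bil]
  bilinear_rsub[OF bil] bilinear_lzero[OF bil] bilinear_rzero[OF bil]

lemma br_anti: "br x y = - br y x"
proof -
  have "br (x + y) (x + y) = 0" by (rule br_self)
  then have "br x y + br y x = 0"
    unfolding bilinear_ladd[OF bil] bilinear_radd[OF bil] by (simp add: br_self add.commute)
  then show ?thesis by (simp add: eq_neg_iff_add_eq_0)
qed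

text \<open>The Jacobi identity in derivation form, used below to push an operator
  \<open>br x\<close> through a bracket.\<close>

lemma jacobi: "br x (br y z) = br (br x y) z + br y (br x z)"
proof -
  have "br x (br y z) + br y (br z x) + br z (br x y) = 0"
    using lie unfolding lie_algebra_def by blast
  moreover have "br y (br z x) = - br y (br x z)"
    by (subst br_anti[of z x]) (simp add: br_simps)
  ultimately show ?thesis
    using br_anti[of z "br x y"] by (simp add: algebra_simps eq_neg_iff_add_eq_0)
qed

lemma linear_theta: "linear \<theta>" and theta_br: "\<theta> (br x y) = br (\<theta> x) (\<theta> y)"
  and theta_theta [simp]: "\<theta> (\<theta> x) = x"
  using cartan unfolding cartan_involution_def by auto

lemma K_sym: "K x y = K y x"
  unfolding killing_form_def by (metis finite_span lin_trace_commute linear_br)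

lemma K_add: "K (x + y) z = K x z + K y z"
  unfolding killing_form_def lin_trace_add[symmetric] by (simp add: comp_def br_simps)

lemma K_cmul: "K (c *\<^sub>R x) z = c * K x z"
  unfolding killing_form_def lin_trace_cmul[symmetric] by (simp add: comp_def br_simps)

lemma bilinear_K: "bilinear K"
proof -
  have "linear (\<lambda>x. K x y)" for y
    by (intro linearI) (simp_all add: K_add K_cmul)
  moreover have "K x = (\<lambda>y. K y x)" for x
    by (rule ext) (rule K_sym)
  ultimately show ?thesis unfolding bilinear_def by metis
qed

text \<open>\<open>br (br x y)\<close> is the commutator of \<open>br x\<close> and
  \<open>br y\<close>. Cyclicity of the trace moves \<open>br y\<close> from the front of one term
  to its end, where the commutator of \<open>br y\<close> and \<open>br z\<close> appears.\<close>

lemma K_invariant: "K (br x y) z = K x (br y z)"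
proof -
  note lin = linear_br linear_compose[OF linear_br linear_br]
  have ad: "br (br x y) v = br x (br y v) - br y (br x v)" for x y v
    using jacobi[of x y v] by (simp add: algebra_simps)
  obtain B :: "'a set" where B: "finite B" "span B = UNIV" by (rule finite_span)
  \<comment> \<open>The difference is written with the factor \<open>-1\<close> so that
    \<open>lin_trace_add\<close> and \<open>lin_trace_cmul\<close> apply.\<close>
  have "K (br x y) z = lin_trace (\<lambda>v. br x (br y (br z v)) + (-1) *\<^sub>R br y (br x (br z v)))"
    by (simp add: killing_form_def comp_def ad)
  also have "\<dots> = lin_trace (\<lambda>v. br x (br y (br z v))) - lin_trace (br y \<circ> (br x \<circ> br z))"
    unfolding lin_trace_add lin_trace_cmul by (simp add: comp_def)
  also have "lin_trace (br y \<circ> (br x \<circ> br z)) = lin_trace ((br x \<circ> br z) \<circ> br y)"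
    by (intro lin_trace_commute[OF _ _ B] lin)
  also have "lin_trace (\<lambda>v. br x (br y (br z v))) - lin_trace ((br x \<circ> br z) \<circ> br y)
      = lin_trace (\<lambda>v. br x (br y (br z v)) + (-1) *\<^sub>R br x (br z (br y v)))"
    unfolding lin_trace_add lin_trace_cmul by (simp add: comp_def)
  also have "\<dots> = K x (br y z)"
    by (simp add: killing_form_def comp_def ad br_simps)
  finally show ?thesis .
qed

lemma ip_pos: "x \<noteq> 0 \<Longrightarrow> ip x x > 0"
  using cartan unfolding cartan_involution_def ip_def by auto

lemma ip_self_eq_0: "ip x x = 0 \<Longrightarrow> x = 0"
  using ip_pos by force

lemma bilinear_ip: "bilinear ip"
  unfolding bilinear_def ip_def
  by (auto intro!: linearI simp: linear_add[OF linear_theta] linear_cmul[OF linear_theta]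
      bilinear_ladd[OF bilinear_K] bilinear_radd[OF bilinear_K]
      bilinear_lmul[OF bilinear_K] bilinear_rmul[OF bilinear_K])

text \<open>Invariance moves \<open>br z\<close> to the other argument of \<open>K\<close>; pulling
  \<theta> out of the bracket there turns \<open>z\<close> into \<open>\<theta> z\<close>.\<close>

lemma ip_adjoint: "ip (br z x) y = - ip x (br (\<theta> z) y)"
proof -
  have "K (br z x) (\<theta> y) = - K (br x z) (\<theta> y)"
    by (subst br_anti) (simp add: bilinear_lneg[OF bilinear_K])
  then show ?thesis
    by (simp add: ip_def theta_br K_invariant)
qed

lemma ip_decomposition:
  assumes "subspace V"
  obtains v t where "v \<in> V" "x = v + t" "\<And>w. w \<in> V \<Longrightarrow> ip t w = 0"
proof -
  obtain B :: "'a set" where B: "finite B" "span B = UNIV" by (rule finite_span)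
  show thesis
    using orthogonal_decomposition[OF bilinear_ip ip_pos assms B] that by blast
qed

end

locale simple_cartan_lie_algebra = cartan_lie_algebra +
  assumes simple: "simple_lie_algebra br"
begin

text \<open>The center is an ideal, and it is not everything because a simple algebra is not
  commutative.\<close>

lemma center_trivial:
  assumes "\<And>y. br x y = 0"
  shows "x = 0"
proof -
  let ?Z = "{x. \<forall>y. br x y = 0}"
  have "lie_ideal br UNIV ?Z"
  proof -
    have "br y x = 0" if "\<forall>u. br x u = 0" for x y
      by (subst br_anti) (simp add: that)
    then show ?thesis
      by (auto simp: lie_ideal_def subspace_def br_simps)
  qed
  with simple have "?Z = {0} \<or> ?Z = UNIV"
    unfolding simple_lie_algebra_def by blast
  moreover have "?Z \<noteq> UNIV"
    using simple unfolding simple_lie_algebra_def lie_commutative_def by blast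
  ultimately show ?thesis using assms by blast
qed

end

section \<open>The action of the Levi subalgebra on the nilradical\<close>

locale two_sided_grading = simple_cartan_lie_algebra +
  fixes a L N :: "'a set"
  assumes subspace_N: "subspace N"
    and a_theta: "\<And>H. H \<in> a \<Longrightarrow> \<theta> H = - H"
    and a_sub_L: "a \<subseteq> L"
    and L_def: "L = centralizer br a"
    and L_N: "\<And>z x. z \<in> L \<Longrightarrow> x \<in> N \<Longrightarrow> br z x \<in> N"
    and N_N: "\<And>x y. x \<in> N \<Longrightarrow> y \<in> N \<Longrightarrow> br x y \<in> N"
    and N_theta: "\<And>x y. x \<in> N \<Longrightarrow> y \<in> N \<Longrightarrow> br x (\<theta> y) \<in> L"
    and N_int_L: "N \<inter> L = {0}"
    and decomp: "\<And>g. \<exists>x\<in>N. \<exists>z\<in>L. \<exists>y\<in>N. g = \<theta> x + z + y"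
begin

lemma L_iff: "z \<in> L \<longleftrightarrow> (\<forall>H\<in>a. br z H = 0)"
  by (simp add: L_def centralizer_def)

lemma br_a_L: "H \<in> a \<Longrightarrow> z \<in> L \<Longrightarrow> br H z = 0"
  by (subst br_anti) (simp add: L_iff)

text \<open>Since \<theta> is \<open>-1\<close> on \<open>a\<close>, it preserves the centralizer of
  \<open>a\<close>.\<close>

lemma theta_L: "z \<in> L \<Longrightarrow> \<theta> z \<in> L"
  unfolding L_iff
proof
  fix H assume z: "\<forall>H\<in>a. br z H = 0" and H: "H \<in> a"
  have "br (\<theta> z) H = \<theta> (br z (\<theta> H))" by (simp add: theta_br)
  also have "\<dots> = 0" using z H by (simp add: a_theta br_simps linear_0[OF linear_theta])
  finally show "br (\<theta> z) H = 0" .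
qed

lemma ad_a_symmetric: "H \<in> a \<Longrightarrow> ip (br H x) y = ip x (br H y)"
  by (simp add: ip_adjoint a_theta br_simps bilinear_rneg[OF bilinear_ip])

lemma ip_decomposition_N:
  assumes "subspace V" "V \<subseteq> N" "x \<in> N"
  obtains v t where "v \<in> V" "t \<in> N" "x = v + t" "\<And>w. w \<in> V \<Longrightarrow> ip t w = 0"
proof -
  obtain v t where vt: "v \<in> V" "x = v + t" "\<And>w. w \<in> V \<Longrightarrow> ip t w = 0"
    using ip_decomposition[OF assms(1)] by blast
  have "x - v \<in> N" using assms vt(1) subspace_N by (intro subspace_diff) auto
  with vt that show thesis by simp
qed

text \<open>For symmetric operators the complement of the image is the kernel: a vector
  \<open>t\<close> of \<open>N\<close> orthogonal to \<open>[a, N]\<close> is killed by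
  \<open>a\<close>, so it lies in both \<open>N\<close> and \<open>L\<close>.\<close>

lemma span_br_a_N: "span {br H x |H x. H \<in> a \<and> x \<in> N} = N" (is "span ?S = N")
proof
  show "span ?S \<subseteq> N"
    using L_N a_sub_L subspace_N by (intro span_minimal) auto
  show "N \<subseteq> span ?S"
  proof
    fix x assume x: "x \<in> N"
    obtain s t where t: "t \<in> N" and st: "s \<in> span ?S" "x = s + t" "\<And>w. w \<in> span ?S \<Longrightarrow> ip t w = 0"
      using ip_decomposition_N[OF subspace_span \<open>span ?S \<subseteq> N\<close> x] by blast
    have "br H t = 0" if H: "H \<in> a" for H
    proof (rule ip_self_eq_0)
      have "br H t \<in> N" using H t a_sub_L L_N by blast
      then have "br H (br H t) \<in> span ?S" using H by (intro span_base) blast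
      then show "ip (br H t) (br H t) = 0" using H st(3) by (simp add: ad_a_symmetric)
    qed
    then have "t \<in> L" unfolding L_iff using br_anti by (metis neg_0_equal_iff_equal)
    with t N_int_L have "t = 0" by blast
    with st show "x \<in> span ?S" by simp
  qed
qed

text \<open>It suffices to treat generators \<open>br H y\<close>; symmetry moves
  \<open>br H\<close> onto \<open>z\<close>, which it kills.\<close>

lemma ip_N_L:
  assumes "x \<in> N" "z \<in> L"
  shows "ip x z = 0"
proof -
  have "x \<in> span {br H x |H x. H \<in> a \<and> x \<in> N}" using assms span_br_a_N by simp
  then show ?thesis
  proof (induction rule: span_induct)
    case base
    show ?case
      by (auto simp: subspace_def bilinear_ladd[OF bilinear_ip] bilinear_lmul[OF bilinear_ip]
          bilinear_lzero[OF bilinear_ip])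
  next
    case (step y)
    then show ?case
      using assms br_a_L by (auto simp: ad_a_symmetric bilinear_rzero[OF bilinear_ip])
  qed
qed

lemma N_commutative:
  assumes "x \<in> N" "y \<in> N"
  shows "br x y = 0"
proof (rule ip_self_eq_0)
  let ?w = "br x y"
  \<comment> \<open>Here \<open>?w\<close> is again in \<open>N\<close>, so \<open>N_theta\<close>
    applies. The outer \<theta> cancels the one built into \<open>ip\<close>.\<close>
  have "\<theta> (br y (\<theta> ?w)) \<in> L"
    using assms N_N N_theta theta_L by blast
  moreover have "ip ?w ?w = ip x (\<theta> (br y (\<theta> ?w)))"
    by (simp add: ip_def K_invariant)
  ultimately show "ip ?w ?w = 0"
    using ip_N_L assms by simp
qed

text \<open>Invariance rewrites the squared norm of \<open>?q\<close> as
  \<open>- ip t (br ?q v)\<close>. As \<open>?q\<close> is in \<open>L\<close>, the vector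
  \<open>br ?q v\<close> stays in \<open>V\<close>, to which \<open>t\<close> is orthogonal.\<close>

lemma br_orthogonal_theta:
  assumes V: "V \<subseteq> N" "\<And>z v. z \<in> L \<Longrightarrow> v \<in> V \<Longrightarrow> br z v \<in> V"
    and t: "t \<in> N" "\<And>v. v \<in> V \<Longrightarrow> ip t v = 0" and v: "v \<in> V"
  shows "br t (\<theta> v) = 0"
proof (rule ip_self_eq_0)
  let ?q = "br t (\<theta> v)"
  have "br ?q v \<in> V" using V t v N_theta by blast
  moreover have "ip ?q ?q = - ip t (br ?q v)"
    unfolding ip_def K_invariant theta_br
    by (subst br_anti) (simp add: theta_br bilinear_rneg[OF bilinear_K])
  ultimately show "ip ?q ?q = 0" using t by simp
qed

text \<open>The span of the set \<open>G\<close> below is the ideal \<open>V + [V, \<theta> V] + \<theta> V\<close>, and the orthogonal complement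
  of \<open>V\<close> in \<open>N\<close> commutes with it, so this complement is central.\<close>

lemma N_irreducible:
  assumes V: "subspace V" "V \<subseteq> N" "\<And>z v. z \<in> L \<Longrightarrow> v \<in> V \<Longrightarrow> br z v \<in> V" and "V \<noteq> {0}"
  shows "V = N"
proof
  define G where "G = V \<union> \<theta> ` V \<union> {br v (\<theta> w) |v w. v \<in> V \<and> w \<in> V}"
  have orth: "br t (\<theta> v) = 0" if "t \<in> N" "\<forall>w\<in>V. ip t w = 0" "v \<in> V" for t v
    using V that by (intro br_orthogonal_theta[of V]) auto
  have G_V: "v \<in> span G" and G_theta: "\<theta> v \<in> span G" if "v \<in> V" for v
    using that by (auto simp: G_def intro: span_base)
  have G_br: "br v (\<theta> w) \<in> span G" if "v \<in> V" "w \<in> V" for v w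
    using that by (auto simp: G_def intro!: span_base)
  have theta_G: "\<theta> x \<in> span G" if "x \<in> span G" for x
    using that
  proof (induction rule: span_induct)
    case base
    show ?case
      by (auto simp: subspace_def linear_0[OF linear_theta] linear_add[OF linear_theta]
          linear_cmul[OF linear_theta] span_zero span_add span_scale)
  next
    case (step x)
    have "br (\<theta> v) w \<in> span G" if "v \<in> V" "w \<in> V" for v w
      by (subst br_anti) (intro span_neg G_br that)
    moreover have "x \<in> V \<or> x \<in> \<theta> ` V \<or> (\<exists>v\<in>V. \<exists>w\<in>V. x = br v (\<theta> w))"
      using step unfolding G_def by blast
    ultimately show ?case
      by (auto simp: theta_br intro: G_V G_theta)
  qed
  have L_theta: "br z (\<theta> v) \<in> \<theta> ` V" if "z \<in> L" "v \<in> V" for z v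
  proof -
    have "br z (\<theta> v) = \<theta> (br (\<theta> z) v)" by (simp add: theta_br)
    with that V(3) theta_L show ?thesis by blast
  qed
  have L_G: "br z x \<in> span G" if z: "z \<in> L" and x: "x \<in> G" for z x
  proof -
    consider "x \<in> V" | "x \<in> \<theta> ` V" | v w where "v \<in> V" "w \<in> V" "x = br v (\<theta> w)"
      using x unfolding G_def by blast
    then show ?thesis
    proof cases
      case 1
      with z V(3) G_V show ?thesis by blast
    next
      case 2
      with z L_theta have "br z x \<in> \<theta> ` V" by auto
      with G_theta show ?thesis by auto
    next
      case 3
      obtain w' where "w' \<in> V" "br z (\<theta> w) = \<theta> w'" using L_theta z 3 by blast
      with 3 z V(3) show ?thesis
        by (simp add: jacobi[of z] span_add G_br)
    qed
  qed
  have N_G: "br x y \<in> span G" if x: "x \<in> N" and y: "y \<in> G" for x y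
  proof -
    obtain u t where "t \<in> N" and ut: "u \<in> V" "x = u + t" "\<And>w. w \<in> V \<Longrightarrow> ip t w = 0"
      using ip_decomposition_N[OF V(1,2) x] by blast
    then have x_theta: "br x (\<theta> w) = br u (\<theta> w)" if "w \<in> V" for w
      using orth[of t w] ut that by (simp add: br_simps)
    consider "y \<in> V" | w where "w \<in> V" "y = \<theta> w" | v w where "v \<in> V" "w \<in> V" "y = br v (\<theta> w)"
      using y unfolding G_def by blast
    then show ?thesis
    proof cases
      case 1
      with x V(2) show ?thesis by (simp add: N_commutative subset_iff span_zero)
    next
      case 2
      with x_theta ut G_br show ?thesis by simp
    next
      case 3
      \<comment> \<open>In the Jacobi expansion the term with \<open>br x v\<close> vanishes as
        \<open>N\<close> is commutative. What remains is, up to sign, an element of \<open>L\<close>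
        acting on \<open>v\<close>.\<close>
      have "br x y = br v (br u (\<theta> w))"
        using 3 x V(2) by (simp add: jacobi[of x] x_theta N_commutative subset_iff br_simps)
      also have "\<dots> = - br (br u (\<theta> w)) v" by (rule br_anti)
      also have "\<dots> \<in> span G"
        using 3 ut(1) V(2) by (intro span_neg G_V V(3) N_theta) auto
      finally show ?thesis .
    qed
  qed
  have span_G: "br x y \<in> span G" if "\<And>y. y \<in> G \<Longrightarrow> br x y \<in> span G" "y \<in> span G" for x y
    using that(2)
  proof (induction rule: span_induct)
    case base
    show ?case by (auto simp: subspace_def br_simps span_zero span_add span_scale)
  next
    case (step y)
    then show ?case by (rule that(1))
  qed
  have "br g y \<in> span G" if y: "y \<in> span G" for g y
  proof -
    obtain x1 z x2 where g: "x1 \<in> N" "z \<in> L" "x2 \<in> N" "g = \<theta> x1 + z + x2"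
      using decomp[of g] by blast
    have "br (\<theta> x1) y = \<theta> (br x1 (\<theta> y))" by (simp add: theta_br)
    also have "\<dots> \<in> span G"
      using g y by (intro theta_G span_G[OF N_G]) auto
    finally have "br (\<theta> x1) y \<in> span G" .
    moreover have "br z y \<in> span G" by (rule span_G[OF L_G[OF g(2)] y])
    moreover have "br x2 y \<in> span G" by (rule span_G[OF N_G[OF g(3)] y])
    ultimately show ?thesis by (simp add: g(4) br_simps span_add)
  qed
  then have "lie_ideal br UNIV (span G)"
    by (simp add: lie_ideal_def)
  moreover have "span G \<noteq> {0}"
    using G_V \<open>V \<noteq> {0}\<close> V(1) subspace_0 by blast
  ultimately have UNIV: "span G = UNIV"
    using simple unfolding simple_lie_algebra_def by blast
  show "N \<subseteq> V"
  proof
    fix x assume x: "x \<in> N"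
    obtain u t where t: "t \<in> N" and ut: "u \<in> V" "x = u + t" "\<And>w. w \<in> V \<Longrightarrow> ip t w = 0"
      using ip_decomposition_N[OF V(1,2) x] by blast
    have t_V: "br t v = 0" "br t (\<theta> v) = 0" if "v \<in> V" for v
      using that t V(2) orth[of t v] ut(3) by (auto simp: N_commutative subset_iff)
    have "br t y = 0" for y
    proof -
      have "y \<in> span G" by (simp add: UNIV)
      then show ?thesis
      proof (induction rule: span_induct)
        case base
        show ?case by (auto simp: subspace_def br_simps)
      next
        case (step y)
        then show ?case
          by (auto simp: G_def t_V jacobi[of t] br_simps)
      qed
    qed
    then have "t = 0" by (rule center_trivial)
    with ut show "x \<in> V" by simp
  qed
qed (rule V(2))

section \<open>The scalar action of \<open>a\<close> on \<open>N\<close>\<close>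

lemma ad_a_scalar:
  assumes H: "H \<in> a" and "N \<noteq> {0}"
  obtains c where "\<And>x. x \<in> N \<Longrightarrow> br H x = c *\<^sub>R x"
proof -
  obtain B :: "'a set" where B: "finite B" "span B = UNIV" by (rule finite_span)
  have H_N: "br H x \<in> N" if "x \<in> N" for x
    using H that a_sub_L L_N by blast
  obtain y c where y: "y \<in> N" "y \<noteq> 0" "br H y = c *\<^sub>R y"
    using symmetric_eigenvector[OF bilinear_ip ip_pos linear_br ad_a_symmetric[OF H] subspace_N H_N
        \<open>N \<noteq> {0}\<close> B] by blast
  \<comment> \<open>The eigenspace is stable under \<open>L\<close> because \<open>br H\<close>
    kills \<open>L\<close> and is a derivation.\<close>
  let ?V = "{x \<in> N. br H x = c *\<^sub>R x}"
  have "?V = N"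
  proof (rule N_irreducible)
    show "subspace ?V"
      using subspace_N by (auto simp: subspace_def br_simps scaleR_add_right)
    show "br z v \<in> ?V" if "z \<in> L" "v \<in> ?V" for z v
      using that H by (auto simp: L_N jacobi[of H] br_a_L br_simps)
    show "?V \<noteq> {0}" using y by blast
  qed auto
  with that show thesis by blast
qed

lemma a_eq_0:
  assumes H: "H \<in> a" "\<And>x. x \<in> N \<Longrightarrow> br H x = 0"
  shows "H = 0"
proof (rule center_trivial)
  fix g
  obtain x z y where g: "x \<in> N" "z \<in> L" "y \<in> N" "g = \<theta> x + z + y"
    using decomp[of g] by blast
  have "br H (\<theta> x) = \<theta> (br (\<theta> H) x)" by (simp add: theta_br)
  also have "\<dots> = 0" using H g by (simp add: a_theta br_simps linear_0[OF linear_theta])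
  finally show "br H g = 0" using H g by (simp add: br_simps br_a_L)
qed

lemma dim_a:
  assumes "subspace a" "a \<noteq> {0}" "N \<noteq> {0}"
  shows "dim a = 1"
proof -
  obtain H where H: "H \<in> a" "H \<noteq> 0"
    using assms subspace_0 by blast
  obtain c where c: "\<And>x. x \<in> N \<Longrightarrow> br H x = c *\<^sub>R x"
    using ad_a_scalar[OF H(1) assms(3)] by blast
  have "c \<noteq> 0" using a_eq_0[OF H(1)] H(2) c by auto
  have "a \<subseteq> span {H}"
  proof
    fix H' assume H': "H' \<in> a"
    obtain c' where c': "\<And>x. x \<in> N \<Longrightarrow> br H' x = c' *\<^sub>R x"
      using ad_a_scalar[OF H' assms(3)] by blast
    \<comment> \<open>The coefficient is chosen so that the combination acts on \<open>N\<close> by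
      the scalar zero.\<close>
    have "H' - (c' / c) *\<^sub>R H = 0"
    proof (rule a_eq_0)
      show "H' - (c' / c) *\<^sub>R H \<in> a"
        using H H' assms(1) by (intro subspace_diff subspace_scale)
      show "br (H' - (c' / c) *\<^sub>R H) x = 0" if "x \<in> N" for x
        using that \<open>c \<noteq> 0\<close> by (simp add: br_simps c c')
    qed
    then have "H' = (c' / c) *\<^sub>R H" by simp
    then show "H' \<in> span {H}" by (simp add: span_base span_scale)
  qed
  moreover have "span {H} \<subseteq> a" using H assms(1) by (intro span_minimal) auto
  ultimately have "a = span {H}" by blast
  moreover have "dim (span {H}) = 1"
    using H(2) by (subst dim_span) (simp add: dim_eq_card_independent)
  ultimately show ?thesis by simp
qed

end

section \<open>The generalized Bruhat decomposition\<close>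

lemma is_direct_sum_two:
  assumes "is_direct_sum X [U, V]"
  shows "X = U + V"
proof
  show "X \<subseteq> U + V"
  proof
    fix x assume "x \<in> X"
    with assms obtain us where us: "list_all2 (\<in>) us [U, V]" "sum_list us = x"
      unfolding is_direct_sum_def by blast
    then show "x \<in> U + V" by (auto simp: list_all2_Cons2)
  qed
  show "U + V \<subseteq> X"
    using assms unfolding is_direct_sum_def
    by (auto simp: set_plus_def subset_iff subspace_add)
qed

lemma is_direct_sum_three:
  assumes "is_direct_sum X [U, V, W]" "x \<in> X"
  obtains u v w where "u \<in> U" "v \<in> V" "w \<in> W" "x = u + v + w"
proof -
  from assms obtain us where "list_all2 (\<in>) us [U, V, W]" "sum_list us = x"
    unfolding is_direct_sum_def by blast
  with that show thesis by (auto simp: list_all2_Cons2 add.assoc)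
qed

text \<open>A common vector \<open>x\<close> has the two representations \<open>[0, x, 0]\<close>
  and \<open>[0, 0, x]\<close>, which uniqueness identifies.\<close>

lemma is_direct_sum_three_Int:
  assumes "is_direct_sum X [U, V, W]"
  shows "V \<inter> W = {0}"
proof -
  have sub: "subspace U" "subspace V" "subspace W" "V \<subseteq> X"
    using assms unfolding is_direct_sum_def by auto
  have "x = 0" if x: "x \<in> V" "x \<in> W" for x
  proof -
    have "\<exists>!us. list_all2 (\<in>) us [U, V, W] \<and> sum_list us = x"
      using assms x(1) sub(4) unfolding is_direct_sum_def by blast
    moreover have "list_all2 (\<in>) [0, x, 0] [U, V, W]" "list_all2 (\<in>) [0, 0, x] [U, V, W]"
      using x sub by (auto simp: subspace_0)
    ultimately have "[0, x, 0] = [0, 0, x]" by (smt (verit) sum_list_simps add_0_left add_0_right)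
    then show ?thesis by simp
  qed
  with sub show ?thesis by (auto simp: subspace_0)
qed

theorem theorem2:
  fixes br :: "'a::real_vector \<Rightarrow> 'a \<Rightarrow> 'a"
    and \<theta> :: "'a \<Rightarrow> 'a"
    and k p h n_plus a m n_minus :: "'a set"
  assumes "simple_lie_algebra br"
    and "\<not> compact_lie_algebra br"
    and "cartan_decomposition br \<theta> k p"
    and "parabolic_subalgebra br h"
    and "h \<noteq> UNIV"
    and "generalized_bruhat_decomposition br \<theta> p h n_plus a m n_minus"
    and "bracket_span br n_plus n_minus \<subseteq> a + m"
  shows "lie_commutative br n_plus \<and> lie_commutative br n_minus \<and> dim a = 1"
proof -
  have langlands: "langlands_decomposition br p h m a n_minus"
    and n_plus: "n_plus = \<theta> ` n_minus"
    and bruhat: "is_direct_sum UNIV [n_plus, a + m, n_minus]"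
    using assms(6) unfolding generalized_bruhat_decomposition_def by auto
  have a: "subspace a" "a \<subseteq> p" "lie_commutative br a"
    and C: "is_direct_sum (centralizer br a) [a, m]"
    and nil: "lie_ideal br h n_minus"
    and h: "is_direct_sum h [m, a, n_minus]"
    using langlands unfolding langlands_decomposition_def is_nilradical_def by auto
  have am: "a + m = centralizer br a" using is_direct_sum_two[OF C] by simp
  have sub: "subspace h" "a \<subseteq> h" "m \<subseteq> h" "n_minus \<subseteq> h" "subspace n_minus"
    using h unfolding is_direct_sum_def by auto
  have am_h: "a + m \<subseteq> h"
    using sub by (auto simp: set_plus_def subset_iff subspace_add)
  interpret simple_cartan_lie_algebra br \<theta>
    using assms(1,3) by unfold_locales
      (auto simp: simple_lie_algebra_def cartan_decomposition_def)
  interpret two_sided_grading br \<theta> a "a + m" n_minus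
  proof unfold_locales
    show "subspace n_minus" by (rule sub)
    show "\<theta> H = - H" if "H \<in> a" for H
      using that a(2) assms(3) unfolding cartan_decomposition_def by auto
    show "a \<subseteq> a + m"
      unfolding am using a(3) by (auto simp: centralizer_def lie_commutative_def)
    show "a + m = centralizer br a" by (rule am)
    show "br z x \<in> n_minus" if "z \<in> a + m" "x \<in> n_minus" for z x
      using that nil am_h unfolding lie_ideal_def by blast
    show "br x y \<in> n_minus" if "x \<in> n_minus" "y \<in> n_minus" for x y
      using that nil sub(4) unfolding lie_ideal_def by blast
    show "br x (\<theta> y) \<in> a + m" if "x \<in> n_minus" "y \<in> n_minus" for x y
    proof -
      \<comment> \<open>The hypothesis has the factor from \<open>n_plus\<close> first;
        \<open>br_anti\<close> then reverses the order at the cost of a sign.\<close>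
      have "br (\<theta> y) x \<in> bracket_span br n_plus n_minus"
        using that unfolding bracket_span_def n_plus by (intro span_base) blast
      with assms(7) have "br (\<theta> y) x \<in> a + m" by blast
      moreover have "subspace (a + m)" using bruhat unfolding is_direct_sum_def by auto
      ultimately show ?thesis by (subst br_anti) (rule subspace_neg)
    qed
    show "n_minus \<inter> (a + m) = {0}" using is_direct_sum_three_Int[OF bruhat] by blast
    show "\<exists>x\<in>n_minus. \<exists>z\<in>a + m. \<exists>y\<in>n_minus. g = \<theta> x + z + y" for g
      using is_direct_sum_three[OF bruhat, of g] unfolding n_plus by blast
  qed
  \<comment> \<open>Otherwise the Bruhat decomposition reduces to \<open>a + m\<close>, which lies
    in the proper subalgebra \<open>h\<close>.\<close>
  have "n_minus \<noteq> {0}"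
  proof
    assume "n_minus = {0}"
    then have "g \<in> a + m" for g
      using decomp[of g] by (auto simp: linear_0[OF linear_theta])
    with am_h assms(5) show False by blast
  qed
  \<comment> \<open>Otherwise the centralizer \<open>a + m\<close> is the whole algebra, again
    contradicting that \<open>h\<close> is proper.\<close>
  moreover have "a \<noteq> {0}"
  proof
    assume "a = {0}"
    then have "centralizer br a = UNIV" by (auto simp: centralizer_def br_simps)
    with am am_h assms(5) show False by auto
  qed
  ultimately have "dim a = 1" using a(1) by (intro dim_a)
  moreover have "lie_commutative br n_minus"
    by (simp add: lie_commutative_def N_commutative)
  moreover have "lie_commutative br n_plus"
    by (auto simp: lie_commutative_def n_plus N_commutative linear_0[OF linear_theta]
        simp flip: theta_br)
  ultimately show ?thesis by blast
qed

end
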